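(* Let $X$ be a doubling metric space, let $E\subset X$ be a nonempty compact set with $E\ne X$, and let $\mathcal{W}(X\setminus E)$ be any fixed Whitney cover of $X\setminus E$. (1) Then $$\underline{\dim}_M(E)\ge\liminf_{k\to\infty}\tfrac1k\log_2\#\mathcal{W}_k(X\setminus E).$$ (2) If $\mu$ is an $s$-regular measure on $X$ (for some $s>0$) and $\mu(E)=0$, then $$\overline{\dim}_M(E)=\limsup_{k\to\infty}\tfrac1k\log_2\#\mathcal{W}_k(X\setminus E).$$
   Context: A metric space $(X,d)$ is doubling if there is $N\in\mathbb{N}$ such that every closed ball $B(x,r)=\{y: d(x,y)\le r\}$, $r>0$, can be covered by $N$ balls of radius $r/2$; $X$ is assumed to contain at least two points. Balls are closed and each ball comes with a fixed center and radius. A measure is a nontrivial Borel regular outer measure for which bounded sets have finite measure. For $s>0$, $\mu$ is $s$-regular on $X$ if there is $C\ge1$ with $C^{-1}r^s\le\mu(B(x,r))\le Cr^s$ for all $x\in X$ and $0<r<\operatorname{diam}(X)$. Minkowski dimensions: for compact $E$ and $\lambda\ge0$, $\mathcal{M}^\lambda_r(E)=\inf\{nr^\lambda: E\subset\bigcup_{k=1}^nB(x_k,r),\ x_k\in E\}$, $\overline{\dim}_M(E)=\inf\{\lambda\ge0:\limsup_{r\downarrow0}\mathcal{M}^\lambda_r(E)=0\}$, $\underline{\dim}_M(E)=\inf\{\lambda\ge0:\liminf_{r\downarrow0}\mathcal{M}^\lambda_r(E)=0\}$. Whitney cover: for an open set $\Omega\subsetneq X$, a Whitney cover $\mathcal{W}(\Omega)$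 is a countable collection $\{B_i\}_{i\in I}$ of closed balls $B_i=B(x_i,r_i)$ with $x_i\in\Omega$, $r_i=\frac18\operatorname{dist}(x_i,X\setminus\Omega)$, $\Omega=\bigcup_iB_i$, and $\sum_i\chi_{B_i}\le C$ for some constant $C\ge1$. For $k\in\mathbb{Z}$, $\mathcal{W}_k(\Omega)=\{B(x_i,r_i)\in\mathcal{W}(\Omega):2^{-k-1}<r_i\le2^{-k}\}$. Convention: $\log_20=-\infty$. *)

theory Defs
  imports "HOL-Analysis.Analysis"
begin

text \<open>
  The metric space \<open>X\<close> is the universe of a type of class \<^class>\<open>metric_space\<close>; \<^const>\<open>cball\<close> is the
  closed ball. Dimensions and growth rates take values in \<^typ>\<open>ereal\<close>, where \<open>Inf {} = \<infinity>\<close>.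
\<close>

definition doubling_space :: "'a::metric_space itself \<Rightarrow> bool" where
  "doubling_space (_::'a itself) \<longleftrightarrow>
     (\<exists>N::nat. \<forall>(x::'a) r. r > 0 \<longrightarrow>
        (\<exists>c::nat \<Rightarrow> 'a. cball x r \<subseteq> (\<Union>i<N. cball (c i) (r / 2))))"

text \<open>
  The diameter of the whole space. The library's \<^const>\<open>diameter\<close> is real-valued and returns \<open>0\<close> on
  unbounded sets, whereas here it has to be \<open>\<infinity>\<close>.
\<close>

definition space_diam :: "'a::metric_space itself \<Rightarrow> ereal" where
  "space_diam (_::'a itself) = (SUP (x::'a, y::'a). ereal (dist x y))"

text \<open>
  Nontrivial Borel regular outer measures that are finite on bounded sets. All subsets of the
  space are in the domain; \<open>lambda_system UNIV UNIV \<mu>\<close> is the family of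
  Caratheodory-measurable sets.
\<close>

definition borel_regular_measure :: "('a::metric_space set \<Rightarrow> ennreal) \<Rightarrow> bool" where
  "borel_regular_measure \<mu> \<longleftrightarrow>
     outer_measure_space UNIV \<mu> \<and>
     sets borel \<subseteq> lambda_system UNIV UNIV \<mu> \<and>
     (\<forall>A. \<exists>B\<in>sets borel. A \<subseteq> B \<and> \<mu> B = \<mu> A) \<and>
     (\<exists>A. \<mu> A \<noteq> 0) \<and>
     (\<forall>A. bounded A \<longrightarrow> \<mu> A < \<infinity>)"

definition regular_measure :: "real \<Rightarrow> ('a::metric_space set \<Rightarrow> ennreal) \<Rightarrow> bool" where
  "regular_measure s \<mu> \<longleftrightarrow>
     (\<exists>C\<ge>1. \<forall>x r. 0 < r \<and> ereal r < space_diam TYPE('a) \<longrightarrow>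
        ennreal (inverse C * r powr s) \<le> \<mu> (cball x r) \<and>
        \<mu> (cball x r) \<le> ennreal (C * r powr s))"

definition minkowski_content :: "real \<Rightarrow> real \<Rightarrow> 'a::metric_space set \<Rightarrow> ereal" where
  "minkowski_content l r E =
     Inf {ereal (real n * r powr l) | n (x::nat \<Rightarrow> 'a).
            E \<subseteq> (\<Union>k\<in>{1..n}. cball (x k) r) \<and> (\<forall>k\<in>{1..n}. x k \<in> E)}"

definition upper_minkowski_dim :: "'a::metric_space set \<Rightarrow> ereal" where
  "upper_minkowski_dim E =
     Inf {ereal l | l. 0 \<le> l \<and> Limsup (at_right 0) (\<lambda>r. minkowski_content l r E) = 0}"

definition lower_minkowski_dim :: "'a::metric_space set \<Rightarrow> ereal" where
  "lower_minkowski_dim E =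
     Inf {ereal l | l. 0 \<le> l \<and> Liminf (at_right 0) (\<lambda>r. minkowski_content l r E) = 0}"

text \<open>
  A Whitney cover is an indexed family of balls, given by centers \<open>c\<close> and radii \<open>\<rho>\<close> over the index
  set \<open>I\<close>. The overlap sum is taken in \<^typ>\<open>ennreal\<close>, where every such sum exists (an infinite
  overlap gives \<open>\<infinity>\<close>).
\<close>

definition whitney_cover ::
  "'a::metric_space set \<Rightarrow> 'i set \<Rightarrow> ('i \<Rightarrow> 'a) \<Rightarrow> ('i \<Rightarrow> real) \<Rightarrow> bool" where
  "whitney_cover \<Omega> I c \<rho> \<longleftrightarrow>
     open \<Omega> \<and> \<Omega> \<noteq> UNIV \<and> countable I \<and>
     (\<forall>i\<in>I. c i \<in> \<Omega> \<and> \<rho> i = infdist (c i) (- \<Omega>) / 8) \<and>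
     \<Omega> = (\<Union>i\<in>I. cball (c i) (\<rho> i)) \<and>
     (\<exists>C::real. C \<ge> 1 \<and>
        (\<forall>y. (\<Sum>\<^sub>\<infinity>i\<in>I. (indicator (cball (c i) (\<rho> i)) y :: ennreal)) \<le> ennreal C))"

text \<open>
  The balls of generation \<open>k\<close>, represented by their indices. A ball carries its center and radius,
  so indices rather than point sets are counted.
\<close>

definition whitney_level :: "'i set \<Rightarrow> ('i \<Rightarrow> real) \<Rightarrow> int \<Rightarrow> 'i set" where
  "whitney_level I \<rho> k = {i\<in>I. 2 powi (- k - 1) < \<rho> i \<and> \<rho> i \<le> 2 powi (- k)}"

text \<open>
  \<open>log\<^sub>2\<close> of the number of elements, with \<open>log\<^sub>2 0 = -\<infinity>\<close>; the value \<open>\<infinity>\<close> on infinite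
  sets avoids the library convention \<open>card A = 0\<close> for infinite \<open>A\<close>.
\<close>

definition log2_card :: "'i set \<Rightarrow> ereal" where
  "log2_card A = (if infinite A then \<infinity> else if A = {} then -\<infinity> else ereal (log 2 (real (card A))))"

definition whitney_rate :: "'i set \<Rightarrow> ('i \<Rightarrow> real) \<Rightarrow> nat \<Rightarrow> ereal" where
  "whitney_rate I \<rho> k = ereal (1 / real k) * log2_card (whitney_level I \<rho> (int k))"

end

theory Submission
  imports Defs
begin

text \<open>
  If \<open>E\<close> is covered by \<open>n\<close> balls of radius \<open>2^-k\<close>, then the centers of the Whitney balls of
  generation \<open>k\<close>, being at distance at most \<open>8 * 2^-k\<close> from \<open>E\<close>, lie in the enlarged balls. By
  doubling and bounded overlap there are at most \<open>D * n\<close> of them, which bounds the lower and upper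
  growth rates by the lower and upper dimensions.

  Conversely, let \<open>U r\<close> be the closed \<open>r\<close>-neighbourhood of \<open>E\<close>. A maximal \<open>r\<close>-separated subset of
  \<open>E\<close> with \<open>n\<close> points has \<open>n * r^s\<close> at most a constant times the measure of \<open>U r\<close>. Up to the null
  set \<open>E\<close>, \<open>U r\<close> is covered by the Whitney balls of radius at most \<open>r\<close>; if generation \<open>k\<close> has at
  most \<open>2^(k m)\<close> balls with \<open>m < s\<close>, a geometric series bounds its measure by a multiple of
  \<open>r^(s - m)\<close>, so \<open>n\<close> is at most a multiple of \<open>r^-m\<close>. If \<open>m \<ge> s\<close>, finiteness of the measure of
  \<open>U 1\<close> gives the exponent \<open>s\<close> instead.
\<close>

section \<open>Dyadic scales, iterated doubling and bounded overlap\<close>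

lemma whitney_level_nat:
  "whitney_level I \<rho> (int k) = {i\<in>I. (1/2) ^ Suc k < \<rho> i \<and> \<rho> i \<le> (1/2) ^ k}"
proof -
  have "(2::real) powi (- int k) = (1/2) ^ k"
    by (simp add: power_int_minus power_one_over inverse_eq_divide)
  moreover have "(2::real) powi (- int k - 1) = (1/2) ^ Suc k"
    by (simp add: power_int_diff power_int_minus power_one_over inverse_eq_divide)
  ultimately show ?thesis
    unfolding whitney_level_def by (simp only: )
qed

text \<open>The exponent is the predecessor of the least \<open>n\<close> with
  \<open>(1/2) ^ n < r\<close>. This links an arbitrary scale to a generation, and also places a
  Whitney ball in its generation.\<close>

lemma dyadic_bracket:
  fixes r :: real
  assumes "0 < r" "r \<le> (1/2) ^ K"
  obtains k where "K \<le> k" "(1/2) ^ Suc k < r" "r \<le> (1/2) ^ k"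
proof -
  define n where "n = (LEAST n. (1/2::real) ^ n < r)"
  have ex: "\<exists>n. (1/2::real) ^ n < r"
    using assms(1) by (intro real_arch_pow_inv) auto
  have n: "(1/2::real) ^ n < r"
    unfolding n_def using ex by (rule LeastI_ex)
  have "(1/2::real) ^ n < (1/2) ^ K"
    using n assms(2) by linarith
  then have "K < n"
    by (simp add: power_strict_decreasing_iff)
  then obtain k where k: "n = Suc k" "K \<le> k"
    by (cases n) auto
  have "\<not> (1/2::real) ^ k < r"
    using not_less_Least[of k "\<lambda>n. (1/2::real) ^ n < r"] k(1) unfolding n_def by auto
  with that k n show thesis by auto
qed

text \<open>Each application of the doubling condition halves the radius and multiplies the number
  of balls by a fixed factor, so \<open>m\<close> applications cost a power of that factor,
  independent of \<open>x\<close> and \<open>r\<close>.\<close>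

lemma doubling_space_cover:
  assumes "doubling_space TYPE('a::metric_space)"
  obtains N :: nat where
    "\<And>(x::'a) r. r > 0 \<Longrightarrow>
      \<exists>S. finite S \<and> card S \<le> N \<and> cball x (2 ^ m * r) \<subseteq> (\<Union>y\<in>S. cball y r)"
proof -
  obtain N where N: "\<And>(x::'a) r. r > 0 \<Longrightarrow>
      \<exists>c::nat \<Rightarrow> 'a. cball x r \<subseteq> (\<Union>i<N. cball (c i) (r / 2))"
    using assms unfolding doubling_space_def by blast
  have "\<exists>S. finite S \<and> card S \<le> N ^ m \<and> cball x (2 ^ m * r) \<subseteq> (\<Union>y\<in>S. cball y r)"
    if "r > 0" for x :: 'a and r
    using that
  proof (induction m arbitrary: x)
    case 0
    show ?case by (intro exI[of _ "{x}"]) simp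
  next
    case (Suc m)
    obtain c :: "nat \<Rightarrow> 'a"
      where "cball x (2 ^ Suc m * r) \<subseteq> (\<Union>i<N. cball (c i) (2 ^ Suc m * r / 2))"
      using N[of "2 ^ Suc m * r" x] Suc.prems by auto
    then have c: "cball x (2 ^ Suc m * r) \<subseteq> (\<Union>i<N. cball (c i) (2 ^ m * r))"
      by simp
    have "\<forall>y::'a. \<exists>S. finite S \<and> card S \<le> N ^ m \<and> cball y (2 ^ m * r) \<subseteq> (\<Union>z\<in>S. cball z r)"
      by (intro allI Suc.IH Suc.prems)
    from choice[OF this] obtain S :: "'a \<Rightarrow> 'a set" where S: "\<And>y. finite (S y)" "\<And>y. card (S y) \<le> N ^ m"
        "\<And>y. cball y (2 ^ m * r) \<subseteq> (\<Union>z\<in>S y. cball z r)"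
      by blast
    have "card (\<Union>i<N. S (c i)) \<le> (\<Sum>i<N. card (S (c i)))"
      by (rule card_UN_le) simp
    also have "\<dots> \<le> (\<Sum>i<N. N ^ m)"
      by (intro sum_mono S)
    finally have "card (\<Union>i<N. S (c i)) \<le> N ^ Suc m" by simp
    moreover have "cball x (2 ^ Suc m * r) \<subseteq> (\<Union>y\<in>(\<Union>i<N. S (c i)). cball y r)"
      using c S(3) by fastforce
    ultimately show ?case
      using S(1) by (intro exI[of _ "\<Union>i<N. S (c i)"]) auto
  qed
  with that show thesis by blast
qed

text \<open>A finite set of indices whose balls contain \<open>y\<close> contributes its cardinality
  to the overlap sum, so it has at most \<open>C\<close> elements. A uniform bound on finite subsets
  makes the whole index set finite with the same bound.\<close>

lemma whitney_cover_overlap: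
  assumes "whitney_cover \<Omega> I c \<rho>"
  obtains K :: nat where
    "\<And>y. finite {i\<in>I. y \<in> cball (c i) (\<rho> i)}" "\<And>y. card {i\<in>I. y \<in> cball (c i) (\<rho> i)} \<le> K"
proof -
  obtain C :: real where C: "C \<ge> 1"
    "\<And>y. (\<Sum>\<^sub>\<infinity>i\<in>I. (indicator (cball (c i) (\<rho> i)) y :: ennreal)) \<le> ennreal C"
    using assms unfolding whitney_cover_def by blast
  have *: "card F \<le> nat \<lfloor>C\<rfloor>" if F: "finite F" "F \<subseteq> {i\<in>I. y \<in> cball (c i) (\<rho> i)}" for F y
  proof -
    have "ennreal (real (card F)) = (\<Sum>i\<in>F. indicator (cball (c i) (\<rho> i)) y)"
      using F(2) by (subst sum.cong[OF refl, where h = "\<lambda>_. 1"])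
        (auto simp: ennreal_of_nat_eq_real_of_nat)
    also have "\<dots> \<le> (\<Sum>\<^sub>\<infinity>i\<in>I. indicator (cball (c i) (\<rho> i)) y)"
      by (subst nonneg_infsum_complete, simp, rule SUP_upper) (use F in auto)
    finally have "ennreal (real (card F)) \<le> ennreal C"
      using C(2)[of y] by (rule order_trans)
    then have "real (card F) \<le> C"
      using C(1) by (simp add: ennreal_le_iff)
    then show ?thesis by linarith
  qed
  show thesis
  proof (rule that)
    fix y
    show fin: "finite {i\<in>I. y \<in> cball (c i) (\<rho> i)}"
      by (rule finite_if_finite_subsets_card_bdd[THEN conjunct1]) (rule *)
    show "card {i\<in>I. y \<in> cball (c i) (\<rho> i)} \<le> nat \<lfloor>C\<rfloor>"
      by (rule *[OF fin order_refl])
  qed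
qed

section \<open>Counting the Whitney balls of a generation by covers of \<open>E\<close>\<close>

text \<open>Near each \<open>x\<close> in \<open>S\<close>, doubling gives at most \<open>N\<close>
  points \<open>y\<close> such that every ball of the generation centered there contains one of
  them. Each \<open>y\<close> lies in at most \<open>K\<close> balls of the cover, so
  \<open>D\<close> depends on neither \<open>k\<close> nor \<open>S\<close>.\<close>

lemma whitney_level_card_le:
  fixes E :: "'a::metric_space set"
  assumes "doubling_space TYPE('a)" and "E \<noteq> {}" and W: "whitney_cover (- E) I c \<rho>"
  obtains D :: nat where "D > 0"
    "\<And>k S. finite S \<Longrightarrow> E \<subseteq> (\<Union>x\<in>S. cball x ((1/2) ^ k)) \<Longrightarrow>
      finite (whitney_level I \<rho> (int k)) \<and> card (whitney_level I \<rho> (int k)) \<le> D * card S"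
proof -
  obtain N where N: "\<And>(x::'a) r. r > 0 \<Longrightarrow>
      \<exists>S. finite S \<and> card S \<le> N \<and> cball x (2 ^ 5 * r) \<subseteq> (\<Union>y\<in>S. cball y r)"
    using doubling_space_cover[OF assms(1)] by metis
  obtain K where K: "\<And>y. finite {i\<in>I. y \<in> cball (c i) (\<rho> i)}"
      "\<And>y. card {i\<in>I. y \<in> cball (c i) (\<rho> i)} \<le> K"
    using whitney_cover_overlap[OF W] by metis
  have rad: "\<rho> i = infdist (c i) E / 8" if "i \<in> I" for i
    using W that unfolding whitney_cover_def by simp
  have main: "finite (whitney_level I \<rho> (int k)) \<and>
      card (whitney_level I \<rho> (int k)) \<le> card S * (N * K)"
    if S: "finite S" "E \<subseteq> (\<Union>x\<in>S. cball x ((1/2) ^ k))" for k S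
  proof -
    let ?W = "\<lambda>y. {i\<in>I. y \<in> cball (c i) (\<rho> i)}"
    define h :: real where "h = (1/2) ^ k"
    have h: "h > 0" unfolding h_def by simp
    have "\<forall>x::'a. \<exists>T. finite T \<and> card T \<le> N \<and> cball x (2 ^ 5 * (h / 2)) \<subseteq> (\<Union>y\<in>T. cball y (h / 2))"
      using N[of "h / 2"] h by simp
    from choice[OF this] obtain T :: "'a \<Rightarrow> 'a set" where T: "\<And>x. finite (T x)" "\<And>x. card (T x) \<le> N"
        "\<And>x. cball x (2 ^ 5 * (h / 2)) \<subseteq> (\<Union>y\<in>T x. cball y (h / 2))"
      by blast
    have sub: "whitney_level I \<rho> (int k) \<subseteq> (\<Union>x\<in>S. \<Union>y\<in>T x. ?W y)"
    proof
      fix i assume "i \<in> whitney_level I \<rho> (int k)"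
      then have i: "i \<in> I" "h / 2 < \<rho> i" "\<rho> i \<le> h"
        by (auto simp: whitney_level_nat h_def)
      \<comment> \<open>The radius condition gives distance at most \<open>8 * h\<close>; the slack
        up to \<open>9 * h\<close> yields a point \<open>e\<close> even if the infimum is not
        attained.\<close>
      have "infdist (c i) E < 9 * h"
        using rad[OF i(1)] i(3) h by linarith
      then obtain e where e: "e \<in> E" "dist (c i) e < 9 * h"
        using assms(2) by (auto simp: infdist_def cINF_less_iff)
      obtain x where x: "x \<in> S" "dist x e \<le> h"
        using e(1) S(2) unfolding h_def by auto
      \<comment> \<open>The distance is at most \<open>h + 9 * h\<close>, and \<open>5\<close> is
        the least exponent for which \<open>2 ^ 5 * (h / 2) = 16 * h\<close> exceeds this.\<close>
      have "dist x (c i) \<le> 2 ^ 5 * (h / 2)"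
        using dist_triangle[of x "c i" e] e(2) x(2) h by (simp add: dist_commute)
      \<comment> \<open>Since \<open>h / 2 < \<rho> i\<close>, this \<open>y\<close> lies in the
        Whitney ball itself, so the overlap bound applies at \<open>y\<close>.\<close>
      then obtain y where "y \<in> T x" "dist y (c i) \<le> h / 2"
        using T(3)[of x] by auto
      with i x show "i \<in> (\<Union>x\<in>S. \<Union>y\<in>T x. ?W y)"
        by (force simp: dist_commute)
    qed
    have fin: "finite (\<Union>x\<in>S. \<Union>y\<in>T x. ?W y)"
      using S(1) T(1) K(1) by blast
    have "card (\<Union>y\<in>T x. ?W y) \<le> N * K" for x
    proof -
      have "card (\<Union>y\<in>T x. ?W y) \<le> (\<Sum>y\<in>T x. card (?W y))"
        by (rule card_UN_le[OF T(1)])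
      also have "\<dots> \<le> card (T x) * K"
        using sum_bounded_above[of "T x" "\<lambda>y. card (?W y)" K] K(2) by simp
      also have "\<dots> \<le> N * K"
        using T(2) by simp
      finally show ?thesis .
    qed
    then have "card (\<Union>x\<in>S. \<Union>y\<in>T x. ?W y) \<le> card S * (N * K)"
      using card_UN_le[OF S(1), of "\<lambda>x. \<Union>y\<in>T x. ?W y"]
        sum_bounded_above[of S "\<lambda>x. card (\<Union>y\<in>T x. ?W y)" "N * K"]
      by (metis (no_types, lifting) of_nat_id order_trans)
    with sub fin show ?thesis
      by (meson card_mono finite_subset order_trans)
  qed
  show thesis
  \<comment> \<open>The added \<open>1\<close> makes the constant positive, so that its logarithm
    can be split off later.\<close>
  proof (rule that[of "N * K + 1"])
    fix k S assume S: "finite S" "E \<subseteq> (\<Union>x\<in>S. cball x ((1/2) ^ k))"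
    have "card S * (N * K) \<le> (N * K + 1) * card S" by simp
    with main[OF S] show "finite (whitney_level I \<rho> (int k)) \<and>
      card (whitney_level I \<rho> (int k)) \<le> (N * K + 1) * card S"
      by linarith
  qed simp
qed

section \<open>Growth rates bounded by the Minkowski dimensions\<close>

lemma whitney_rate_le:
  assumes "finite (whitney_level I \<rho> (int k))"
    and "real (card (whitney_level I \<rho> (int k))) \<le> b"
    and "k > 0" "b > 0"
  shows "whitney_rate I \<rho> k \<le> ereal (log 2 b / real k)"
proof (cases "whitney_level I \<rho> (int k) = {}")
  case True
  then show ?thesis
    using assms(3) by (simp add: whitney_rate_def log2_card_def)
next
  case False
  then have "0 < card (whitney_level I \<rho> (int k))"
    using assms(1) by (simp add: card_gt_0_iff)
  then have "log 2 (real (card (whitney_level I \<rho> (int k)))) \<le> log 2 b"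
    using assms(2,4) by (subst log_le_cancel_iff) auto
  with False assms(1,3) show ?thesis
    by (simp add: whitney_rate_def log2_card_def divide_right_mono)
qed

lemma whitney_rate_lessD:
  assumes "whitney_rate I \<rho> k < ereal t" and "k > 0"
  shows "finite (whitney_level I \<rho> (int k))"
    and "real (card (whitney_level I \<rho> (int k))) \<le> 2 powr (real k * t)"
proof -
  show fin: "finite (whitney_level I \<rho> (int k))"
    using assms by (auto simp: whitney_rate_def log2_card_def split: if_splits)
  show "real (card (whitney_level I \<rho> (int k))) \<le> 2 powr (real k * t)"
  proof (cases "whitney_level I \<rho> (int k) = {}")
    case False
    then have pos: "0 < card (whitney_level I \<rho> (int k))"
      using fin by (simp add: card_gt_0_iff)
    have "log 2 (real (card (whitney_level I \<rho> (int k)))) / real k < t"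
      using assms fin False by (simp add: whitney_rate_def log2_card_def)
    then have "log 2 (real (card (whitney_level I \<rho> (int k)))) \<le> real k * t"
      using assms(2) by (simp add: field_simps)
    then show ?thesis
      using pos by (simp add: log_le_iff)
  qed simp
qed

text \<open>Content below \<open>1\<close> at scale \<open>r\<close> gives a cover by
  \<open>n\<close> balls with \<open>n < r powr (- l)\<close>, which is at most
  \<open>2 powr ((k + 1) * l)\<close>. Counting and taking logarithms give the bound. Working at one
  scale with a uniform \<open>D\<close> serves both the lower and the upper dimension.\<close>

lemma whitney_rate_le_of_content:
  fixes E :: "'a::metric_space set"
  assumes "doubling_space TYPE('a)" and "E \<noteq> {}" and W: "whitney_cover (- E) I c \<rho>"
  obtains D :: real where
    "\<And>k l r. 0 \<le> l \<Longrightarrow> k > 0 \<Longrightarrow> (1/2) ^ Suc k < r \<Longrightarrow> r \<le> (1/2) ^ k \<Longrightarrow>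
      minkowski_content l r E < 1 \<Longrightarrow> whitney_rate I \<rho> k \<le> ereal ((D + (real k + 1) * l) / real k)"
proof -
  obtain D :: nat where D: "D > 0"
    "\<And>k S. finite S \<Longrightarrow> E \<subseteq> (\<Union>x\<in>S. cball x ((1/2) ^ k)) \<Longrightarrow>
      finite (whitney_level I \<rho> (int k)) \<and> card (whitney_level I \<rho> (int k)) \<le> D * card S"
    using whitney_level_card_le[OF assms] by metis
  have "whitney_rate I \<rho> k \<le> ereal ((log 2 (real D) + (real k + 1) * l) / real k)"
    if l: "0 \<le> l" "k > 0" and r: "(1/2) ^ Suc k < r" "r \<le> (1/2) ^ k"
      and M: "minkowski_content l r E < 1" for k l r
  proof -
    obtain n x where n: "real n * r powr l < 1"
        "E \<subseteq> (\<Union>j\<in>{1..n}. cball (x j) r)"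
      using M unfolding minkowski_content_def Inf_less_iff by auto
    have r0: "0 < r"
      by (rule le_less_trans[OF _ r(1)]) simp
    let ?S = "x ` {1..n}"
    \<comment> \<open>Enlarging the radius from \<open>r\<close> to the dyadic one keeps the number
      of balls.\<close>
    have "E \<subseteq> (\<Union>y\<in>?S. cball y ((1/2) ^ k))"
      using n(2) r(2) by (fastforce intro: order_trans)
    then have *: "finite (whitney_level I \<rho> (int k))"
        "card (whitney_level I \<rho> (int k)) \<le> D * card ?S"
      using D(2)[of ?S k] by auto
    have "card ?S \<le> n"
      using card_image_le[of "{1..n}" x] by simp
    with *(2) have le: "card (whitney_level I \<rho> (int k)) \<le> D * n"
      by (meson mult_le_mono2 order_trans)
    have "(1/2) ^ Suc k = (2::real) powr (- (real k + 1))"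
      by (simp add: powr_minus powr_add powr_realpow power_one_over inverse_eq_divide del: minus_add_distrib)
    then have "2 powr (- (real k + 1) * l) \<le> r powr l"
      using powr_mono2[OF l(1) _ less_imp_le[OF r(1)]] by (simp add: powr_powr)
    then have "real n * 2 powr (- (real k + 1) * l) \<le> real n * r powr l"
      by (rule mult_left_mono) simp
    with n(1) have "real n * 2 powr (- (real k + 1) * l) \<le> 1"
      by linarith
    then have "real n * 2 powr (- (real k + 1) * l) * 2 powr ((real k + 1) * l) \<le> 1 * 2 powr ((real k + 1) * l)"
      by (rule mult_right_mono) simp
    moreover have "real n * 2 powr (- (real k + 1) * l) * 2 powr ((real k + 1) * l) = real n"
      by (simp only: mult.assoc powr_add[symmetric]) (simp add: algebra_simps)
    ultimately have "real n \<le> 2 powr ((real k + 1) * l)"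
      by (simp only: mult_1)
    then have "real D * real n \<le> real D * 2 powr ((real k + 1) * l)"
      by (rule mult_left_mono) simp
    moreover have "real (card (whitney_level I \<rho> (int k))) \<le> real D * real n"
      using le by (simp flip: of_nat_mult)
    ultimately have "real (card (whitney_level I \<rho> (int k))) \<le> real D * 2 powr ((real k + 1) * l)"
      by linarith
    from whitney_rate_le[OF *(1) this l(2)] show ?thesis
      using D(1) by (simp add: log_mult log_powr)
  qed
  with that show thesis by blast
qed

lemma tendsto_affine_over:
  fixes D l :: real
  shows "(\<lambda>k. ereal ((D + (real k + 1) * l) / real k)) \<longlonglongrightarrow> ereal l"
proof -
  have "(\<lambda>k. (D + l) / real k + l) \<longlonglongrightarrow> 0 + l"
    by (intro tendsto_intros lim_const_over_n)
  moreover have "\<forall>\<^sub>F k in sequentially. (D + l) / real k + l = (D + (real k + 1) * l) / real k"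
    using eventually_gt_at_top[of 0] by eventually_elim (simp add: field_simps)
  ultimately have "(\<lambda>k. (D + (real k + 1) * l) / real k) \<longlonglongrightarrow> l"
    by (auto intro: Lim_transform_eventually)
  then show ?thesis by simp
qed

lemma liminf_whitney_rate_le_lower_minkowski_dim:
  fixes E :: "'a::metric_space set"
  assumes "doubling_space TYPE('a)" and "E \<noteq> {}" and W: "whitney_cover (- E) I c \<rho>"
  shows "liminf (whitney_rate I \<rho>) \<le> lower_minkowski_dim E"
  unfolding lower_minkowski_dim_def
proof (rule Inf_greatest, clarify)
  fix l :: real assume l: "0 \<le> l" and Z: "Liminf (at_right 0) (\<lambda>r. minkowski_content l r E) = 0"
  obtain D :: real where D:
    "\<And>k l r. 0 \<le> l \<Longrightarrow> k > 0 \<Longrightarrow> (1/2) ^ Suc k < r \<Longrightarrow> r \<le> (1/2) ^ k \<Longrightarrow>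
      minkowski_content l r E < 1 \<Longrightarrow> whitney_rate I \<rho> k \<le> ereal ((D + (real k + 1) * l) / real k)"
    using whitney_rate_le_of_content[OF assms] by metis
  show "liminf (whitney_rate I \<rho>) \<le> ereal l"
  proof (rule ccontr)
    assume "\<not> ?thesis"
    then obtain m where m: "ereal l < m" "m < liminf (whitney_rate I \<rho>)"
      using dense by (metis not_le)
    have "\<forall>\<^sub>F k in sequentially. m < whitney_rate I \<rho> k \<and>
        ereal ((D + (real k + 1) * l) / real k) < m \<and> k > 0"
      using less_LiminfD[OF m(2)] order_tendstoD(2)[OF tendsto_affine_over m(1)]
        eventually_gt_at_top[of 0]
      by eventually_elim auto
    then obtain K where K: "\<And>k. k \<ge> K \<Longrightarrow> m < whitney_rate I \<rho> k \<and>
        ereal ((D + (real k + 1) * l) / real k) < m \<and> k > 0"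
      by (auto simp: eventually_sequentially)
    \<comment> \<open>Content below \<open>1\<close> at any such \<open>r\<close> would push the
      rate of the generation bracketing \<open>r\<close> below \<open>m\<close>.\<close>
    have "1 \<le> minkowski_content l r E" if r: "0 < r" "r \<le> (1/2) ^ K" for r
    proof -
      obtain k where k: "K \<le> k" "(1/2) ^ Suc k < r" "r \<le> (1/2) ^ k"
        using dyadic_bracket[OF r] .
      show ?thesis
        using D[OF l _ k(2,3)] K[OF k(1)] by force
    qed
    then have "\<forall>\<^sub>F r in at_right 0. 1 \<le> minkowski_content l r E"
      unfolding eventually_at_right_field
      by (intro exI[of _ "(1/2) ^ K"]) auto
    then have "1 \<le> Liminf (at_right 0) (\<lambda>r. minkowski_content l r E)"
      by (rule Liminf_bounded)
    with Z show False by simp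
  qed
qed

lemma limsup_whitney_rate_le_upper_minkowski_dim:
  fixes E :: "'a::metric_space set"
  assumes "doubling_space TYPE('a)" and "E \<noteq> {}" and W: "whitney_cover (- E) I c \<rho>"
  shows "limsup (whitney_rate I \<rho>) \<le> upper_minkowski_dim E"
  unfolding upper_minkowski_dim_def
proof (rule Inf_greatest, clarify)
  fix l :: real assume l: "0 \<le> l" and Z: "Limsup (at_right 0) (\<lambda>r. minkowski_content l r E) = 0"
  obtain D :: real where D:
    "\<And>k l r. 0 \<le> l \<Longrightarrow> k > 0 \<Longrightarrow> (1/2) ^ Suc k < r \<Longrightarrow> r \<le> (1/2) ^ k \<Longrightarrow>
      minkowski_content l r E < 1 \<Longrightarrow> whitney_rate I \<rho> k \<le> ereal ((D + (real k + 1) * l) / real k)"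
    using whitney_rate_le_of_content[OF assms] by metis
  have "\<forall>\<^sub>F r in at_right 0. minkowski_content l r E < 1"
    by (rule Limsup_lessD) (simp add: Z)
  \<comment> \<open>A vanishing upper limit controls all small radii, so the dyadic ones
    suffice.\<close>
  then have "\<forall>\<^sub>F k in sequentially. minkowski_content l ((1/2) ^ k) E < 1"
    by (rule eventually_compose_filterlim)
      (auto intro!: tendsto_imp_filterlim_at_right LIMSEQ_power_zero)
  then have "\<forall>\<^sub>F k in sequentially. whitney_rate I \<rho> k \<le> ereal ((D + (real k + 1) * l) / real k)"
    using eventually_gt_at_top[of 0]
    by eventually_elim (rule D[OF l]; simp)
  then have "limsup (whitney_rate I \<rho>) \<le>
      limsup (\<lambda>k. ereal ((D + (real k + 1) * l) / real k))"
    by (rule Limsup_mono)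
  also have "\<dots> = ereal l"
    by (rule lim_imp_Limsup[OF _ tendsto_affine_over]) simp
  finally show "limsup (whitney_rate I \<rho>) \<le> ereal l" .
qed

section \<open>Measure of neighbourhoods of \<open>E\<close>\<close>

text \<open>By Caratheodory's theorem \<open>\<mu>\<close> is countably additive on its measurable
  sets, which include the Borel sets. The restriction is a genuine measure, to which the
  \<open>emeasure\<close> calculus applies.\<close>

lemma borel_regular_measureE:
  fixes \<mu> :: "'a::metric_space set \<Rightarrow> ennreal"
  assumes "borel_regular_measure \<mu>"
  obtains M :: "'a measure"
    where "sets M = sets borel" "\<And>A. A \<in> sets borel \<Longrightarrow> emeasure M A = \<mu> A"
proof -
  interpret P: sigma_algebra UNIV "UNIV :: 'a set set"
    using sigma_algebra_Pow[of "UNIV :: 'a set"] by simp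
  have "measure_space UNIV (lambda_system UNIV UNIV \<mu>) \<mu>"
    using assms P.caratheodory_lemma unfolding borel_regular_measure_def by blast
  moreover have "sets borel \<subseteq> lambda_system UNIV UNIV \<mu>"
    using assms unfolding borel_regular_measure_def by blast
  ultimately have ca: "positive (sets borel) \<mu>" "countably_additive (sets borel) \<mu>"
    unfolding measure_space_def positive_def countably_additive_def by blast+
  have sa: "sigma_algebra UNIV (sets (borel :: 'a measure))"
    using sets.sigma_algebra_axioms[of "borel :: 'a measure"] by simp
  show thesis
  proof (rule that[of "measure_of UNIV (sets borel) \<mu>"])
    show "sets (measure_of UNIV (sets borel) \<mu>) = sets borel"
      using sigma_algebra.sets_measure_of_eq[OF sa] by simp
    show "emeasure (measure_of UNIV (sets borel) \<mu>) A = \<mu> A" if "A \<in> sets borel" for A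
      by (rule emeasure_measure_of_sigma[OF sa ca that])
  qed
qed

lemma closed_infdist_le: "closed {z. infdist z E \<le> r}"
  by (intro closed_Collect_le continuous_intros)

lemma bounded_infdist_le:
  assumes "bounded E" "E \<noteq> {}"
  shows "bounded {z. infdist z E \<le> r}"
proof -
  obtain a R where R: "\<And>e. e \<in> E \<Longrightarrow> dist a e \<le> R"
    using assms(1) unfolding bounded_def by blast
  have "dist a z \<le> R + (r + 1)" if "infdist z E \<le> r" for z
  proof -
    have "infdist z E < r + 1" using that by simp
    then obtain e where "e \<in> E" "dist z e < r + 1"
      using assms(2) by (auto simp: infdist_def cINF_less_iff)
    then show ?thesis
      using R[of e] dist_triangle[of a z e] by (simp add: dist_commute)
  qed
  then show ?thesis unfolding bounded_def by blast
qed

text \<open>Generation \<open>j\<close> has total measure at most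
  \<open>2 powr (j * t) * C * 2 powr (- j * s) = C * q ^ j\<close> with
  \<open>q = 2 powr (t - s) < 1\<close>, and the generations meeting the neighbourhood form a tail
  of this series.\<close>

lemma emeasure_neighbourhood_le:
  fixes E :: "'a::metric_space set"
  assumes W: "whitney_cover (- E) I c \<rho>" and "E \<noteq> {}"
    and M: "sets M = sets borel" "emeasure M E = 0"
    and C: "C \<ge> 0" "0 \<le> s"
    and ball: "\<And>x r. 0 < r \<Longrightarrow> r \<le> (1/2) ^ K \<Longrightarrow> emeasure M (cball x r) \<le> ennreal (C * r powr s)"
    and lev: "\<And>k. k \<ge> K \<Longrightarrow> finite (whitney_level I \<rho> (int k)) \<and>
      real (card (whitney_level I \<rho> (int k))) \<le> 2 powr (real k * t)"
    and "t < s"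
  obtains A where "A \<ge> 0"
    "\<And>r. 0 < r \<Longrightarrow> r \<le> (1/2) ^ K \<Longrightarrow> emeasure M {z. infdist z E \<le> r} \<le> ennreal (A * r powr (s - t))"
proof -
  define q :: real where "q = 2 powr (t - s)"
  have q: "0 < q" "q < 1"
    using \<open>t < s\<close> unfolding q_def by (auto simp: powr_less_one)
  have qpow: "q ^ j = 2 powr (real j * (t - s))" for j
    unfolding q_def by (simp add: powr_powr mult.commute flip: powr_realpow)
  have half: "((1/2::real) ^ j) = 2 powr (- real j)" for j
    by (simp add: powr_minus powr_realpow power_one_over inverse_eq_divide)
  define V where "V j = (\<Union>i\<in>whitney_level I \<rho> (int j). cball (c i) (\<rho> i))" for j
  have clE: "closed E"
    using W unfolding whitney_cover_def by (metis closed_def)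
  \<comment> \<open>Positivity, from closedness of \<open>E\<close>, ensures that every ball belongs
    to some generation.\<close>
  have rad: "\<rho> i = infdist (c i) E / 8" "0 < \<rho> i" if "i \<in> I" for i
  proof -
    have "c i \<notin> E" and eq: "\<rho> i = infdist (c i) E / 8"
      using W that unfolding whitney_cover_def by auto
    then show "\<rho> i = infdist (c i) E / 8" "0 < \<rho> i"
      using infdist_pos_not_in_closed[OF clE \<open>E \<noteq> {}\<close>, of "c i"] by auto
  qed
  have V: "emeasure M (V j) \<le> ennreal (C * q ^ j)" "V j \<in> sets M" if "K \<le> j" for j
  proof -
    let ?L = "whitney_level I \<rho> (int j)"
    have fin: "finite ?L" using lev[OF that] by simp
    have "closed (V j)" unfolding V_def using fin by (intro closed_UN) auto
    then show "V j \<in> sets M" using M(1) by simp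
    have "emeasure M (V j) \<le> (\<Sum>i\<in>?L. emeasure M (cball (c i) (\<rho> i)))"
      unfolding V_def by (rule emeasure_subadditive_finite[OF fin]) (auto simp: M(1))
    also have "\<dots> \<le> (\<Sum>i\<in>?L. ennreal (C * 2 powr (- real j * s)))"
    proof (rule sum_mono)
      fix i assume i: "i \<in> ?L"
      then have i': "0 < \<rho> i" "\<rho> i \<le> (1/2) ^ j"
        using rad(2) by (auto simp: whitney_level_nat)
      have "(1/2::real) ^ j \<le> (1/2) ^ K"
        using that by (intro power_decreasing) auto
      with i'(2) have "\<rho> i \<le> (1/2) ^ K"
        by (rule order_trans)
      then have "emeasure M (cball (c i) (\<rho> i)) \<le> ennreal (C * \<rho> i powr s)"
        by (rule ball[OF i'(1)])
      also have "\<rho> i powr s \<le> ((1/2) ^ j) powr s"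
        using i' C(2) by (intro powr_mono2) auto
      then have "ennreal (C * \<rho> i powr s) \<le> ennreal (C * 2 powr (- real j * s))"
        using C(1) unfolding half powr_powr by (intro ennreal_leI mult_left_mono) auto
      finally show "emeasure M (cball (c i) (\<rho> i)) \<le> ennreal (C * 2 powr (- real j * s))" .
    qed
    also have "\<dots> = ennreal (real (card ?L) * (C * 2 powr (- real j * s)))"
      using C(1) by (simp add: ennreal_mult ennreal_of_nat_eq_real_of_nat)
    also have "\<dots> \<le> ennreal (2 powr (real j * t) * (C * 2 powr (- real j * s)))"
      using lev[OF that] C(1) by (intro ennreal_leI mult_right_mono) auto
    also have "2 powr (real j * t) * (C * 2 powr (- real j * s)) = C * q ^ j"
      unfolding qpow by (simp add: powr_diff powr_minus divide_simps right_diff_distrib)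
    finally show "emeasure M (V j) \<le> ennreal (C * q ^ j)" .
  qed
  \<comment> \<open>The first factor sums the geometric tail; the second pays for replacing
    \<open>(1/2) ^ k\<close> by \<open>2 * r\<close>.\<close>
  define A where "A = C / (1 - q) * 2 powr (s - t)"
  have A0: "A \<ge> 0" unfolding A_def using C q by simp
  have "emeasure M {z. infdist z E \<le> r} \<le> ennreal (A * r powr (s - t))"
    if r: "0 < r" "r \<le> (1/2) ^ K" for r
  proof -
    obtain k where k: "K \<le> k" "(1/2) ^ Suc k < r" "r \<le> (1/2) ^ k"
      using dyadic_bracket[OF r] .
    have sub: "{z. infdist z E \<le> r} \<subseteq> E \<union> (\<Union>j. V (k + j))"
    proof (clarify, rule ccontr)
      fix z assume z: "infdist z E \<le> r" "z \<notin> (\<Union>j. V (k + j))" "z \<notin> E"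
      from z(3) obtain i where i: "i \<in> I" "z \<in> cball (c i) (\<rho> i)"
        using W unfolding whitney_cover_def by blast
      \<comment> \<open>The triangle inequality gives
        \<open>8 * \<rho> i \<le> r + \<rho> i\<close>, hence even
        \<open>\<rho> i \<le> r / 7\<close>.\<close>
      have "\<rho> i \<le> (1/2) ^ k"
        using infdist_triangle[of "c i" E z] rad[OF i(1)] i(2) z(1) k(3) by simp
      then obtain j where j: "k \<le> j" "(1/2) ^ Suc j < \<rho> i" "\<rho> i \<le> (1/2) ^ j"
        using dyadic_bracket[OF rad(2)[OF i(1)]] by metis
      then have "z \<in> V (k + (j - k))"
        unfolding V_def whitney_level_nat using i by auto
      with z(2) show False by blast
    qed
    have Vs: "(\<Union>j. V (k + j)) \<in> sets M"
      using V(2) k(1) by (intro sets.countable_UN) auto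
    have Es: "E \<in> sets M" using clE M(1) by simp
    have "emeasure M {z. infdist z E \<le> r} \<le> emeasure M (E \<union> (\<Union>j. V (k + j)))"
      by (rule emeasure_mono[OF sub]) (use Vs Es in blast)
    also have "\<dots> \<le> emeasure M (\<Union>j. V (k + j))"
      using emeasure_subadditive[OF Es Vs] M(2) by simp
    also have "\<dots> \<le> (\<Sum>j. emeasure M (V (k + j)))"
      using V(2) k(1) by (intro emeasure_subadditive_countably) auto
    also have "\<dots> \<le> (\<Sum>j. ennreal (C * q ^ (k + j)))"
      using V(1) k(1) by (intro suminf_le) auto
    also have "\<dots> = ennreal (C * q ^ k * (1 / (1 - q)))"
    proof (rule suminf_ennreal_eq)
      have "(\<lambda>j. C * q ^ k * q ^ j) sums (C * q ^ k * (1 / (1 - q)))"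
        using q by (intro sums_mult geometric_sums) auto
      then show "(\<lambda>j. C * q ^ (k + j)) sums (C * q ^ k * (1 / (1 - q)))"
        by (simp add: power_add mult.assoc)
    qed (use C q in simp)
    also have "\<dots> \<le> ennreal (A * r powr (s - t))"
    proof (rule ennreal_leI)
      have "q ^ k = ((1/2) ^ k) powr (s - t)"
        unfolding half qpow powr_powr by (simp add: algebra_simps)
      also have "\<dots> \<le> (2 * r) powr (s - t)"
        using k(2) \<open>t < s\<close> by (intro powr_mono2) auto
      also have "\<dots> = 2 powr (s - t) * r powr (s - t)"
        using r by (simp add: powr_mult)
      finally have "C / (1 - q) * q ^ k \<le> C / (1 - q) * (2 powr (s - t) * r powr (s - t))"
        using C(1) q by (intro mult_left_mono) auto
      then show "C * q ^ k * (1 / (1 - q)) \<le> A * r powr (s - t)"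
        unfolding A_def by (simp add: mult.assoc)
    qed
    finally show ?thesis .
  qed
  with A0 that show thesis by blast
qed

section \<open>From measure bounds to covers and the upper dimension\<close>

text \<open>A packing argument: balls of radius \<open>r / 2\<close> around
  \<open>r\<close>-separated points of \<open>E\<close> are disjoint and lie in the
  \<open>r\<close>-neighbourhood, so there are at most \<open>B / v\<close> such points. A separated
  set of greatest cardinality is then an \<open>r\<close>-net.\<close>

lemma maximal_separated_cover:
  fixes E :: "'a::metric_space set"
  assumes "E \<noteq> {}" and M: "sets M = sets borel" and "0 < r" "0 < v" "0 \<le> B"
    and low: "\<And>x. ennreal v \<le> emeasure M (cball x (r / 2))"
    and up: "emeasure M {z. infdist z E \<le> r} \<le> ennreal B"
  obtains n :: nat and x :: "nat \<Rightarrow> 'a" where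
    "n \<ge> 1" "E \<subseteq> (\<Union>k\<in>{1..n}. cball (x k) r)" "\<forall>k\<in>{1..n}. x k \<in> E" "real n * v \<le> B"
proof -
  \<comment> \<open>Strict separation makes the closed half-radius balls disjoint, and it is exactly
    what a point outside all closed \<open>r\<close>-balls satisfies.\<close>
  define P where "P F \<longleftrightarrow> finite F \<and> F \<subseteq> E \<and> (\<forall>x\<in>F. \<forall>y\<in>F. x \<noteq> y \<longrightarrow> r < dist x y)" for F
  have bd: "real (card F) * v \<le> B" if "P F" for F
  proof -
    have F: "finite F" "F \<subseteq> E" "\<And>x y. x \<in> F \<Longrightarrow> y \<in> F \<Longrightarrow> x \<noteq> y \<Longrightarrow> r < dist x y"
      using that unfolding P_def by auto
    have dis: "disjoint_family_on (\<lambda>x. cball x (r / 2)) F"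
      unfolding disjoint_family_on_def
    proof (intro ballI impI equals0I)
      fix x y z assume *: "x \<in> F" "y \<in> F" "x \<noteq> y" "z \<in> cball x (r / 2) \<inter> cball y (r / 2)"
      then have "dist x y \<le> r"
        using dist_triangle[of x y z] by (simp add: dist_commute)
      with F(3)[OF *(1-3)] show False by simp
    qed
    have "ennreal (real (card F) * v) = (\<Sum>x\<in>F. ennreal v)"
      using \<open>0 < v\<close> by (simp add: ennreal_mult ennreal_of_nat_eq_real_of_nat)
    also have "\<dots> \<le> (\<Sum>x\<in>F. emeasure M (cball x (r / 2)))"
      by (intro sum_mono low)
    also have "\<dots> = emeasure M (\<Union>x\<in>F. cball x (r / 2))"
      by (rule sum_emeasure[OF _ dis F(1)]) (auto simp: M)
    also have "\<dots> \<le> emeasure M {z. infdist z E \<le> r}"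
    proof (rule emeasure_mono)
      show "(\<Union>x\<in>F. cball x (r / 2)) \<subseteq> {z. infdist z E \<le> r}"
      proof clarify
        fix x z assume *: "x \<in> F" "z \<in> cball x (r / 2)"
        then have "dist z x \<le> r"
          using \<open>0 < r\<close> by (simp add: dist_commute)
        then show "infdist z E \<le> r"
          using * F(2) by (intro infdist_le2[of x]) auto
      qed
      show "{z. infdist z E \<le> r} \<in> sets M"
        using borel_closed[OF closed_infdist_le] M by simp
    qed
    also note up
    finally show ?thesis
      using \<open>0 \<le> B\<close> by (simp add: ennreal_le_iff)
  qed
  obtain e0 where e0: "e0 \<in> E" using \<open>E \<noteq> {}\<close> by blast
  have P0: "P {e0}" unfolding P_def using e0 by simp
  have "card F \<le> nat \<lceil>B / v\<rceil>" if "P F" for F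
  proof -
    have "real (card F) \<le> B / v"
      using bd[OF that] \<open>0 < v\<close> by (simp add: field_simps)
    then show ?thesis by linarith
  qed
  then obtain F where F: "P F" "\<And>G. P G \<Longrightarrow> card G \<le> card F"
    using ex_has_greatest_nat[of P "{e0}" card "Suc (nat \<lceil>B / v\<rceil>)", OF P0] by (auto simp: less_Suc_eq_le)
  have fin: "finite F" "F \<subseteq> E" using F(1) unfolding P_def by auto
  have cov: "E \<subseteq> (\<Union>x\<in>F. cball x r)"
  proof (rule ccontr)
    assume "\<not> ?thesis"
    then obtain e where "e \<in> E" "e \<notin> (\<Union>x\<in>F. cball x r)"
      by blast
    then have e: "e \<in> E" "\<And>x. x \<in> F \<Longrightarrow> r < dist x e"
      by (auto simp: not_le)
    then have "e \<notin> F" using \<open>0 < r\<close> by force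
    have "P (insert e F)"
      using F(1) e unfolding P_def by (auto simp: dist_commute)
    from F(2)[OF this] show False using \<open>e \<notin> F\<close> fin(1) by simp
  qed
  obtain x where "bij_betw x {1..card F} F"
    using ex_bij_betw_nat_finite_1[OF fin(1)] by blast
  then have x: "x ` {1..card F} = F" by (simp add: bij_betw_def)
  show thesis
  proof (rule that)
    show "1 \<le> card F" using F(2)[OF P0] by simp
    have "E \<subseteq> (\<Union>y\<in>x ` {1..card F}. cball y r)"
      using cov x by simp
    then show "E \<subseteq> (\<Union>k\<in>{1..card F}. cball (x k) r)"
      by simp
    show "\<forall>k\<in>{1..card F}. x k \<in> E" using x fin(2) by blast
    show "real (card F) * v \<le> B" using bd[OF F(1)] .
  qed
qed

lemma tendsto_powr_at_right_0:
  fixes H p :: real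
  assumes "0 < p"
  shows "((\<lambda>r. H * r powr p) \<longlongrightarrow> 0) (at_right 0)"
proof -
  have "((\<lambda>r::real. r powr p) \<longlongrightarrow> 0) (at_right 0)"
    using assms by (intro tendsto_zero_powrI[where b = p] tendsto_intros)
      (auto simp: eventually_at_right_field intro: exI[of _ 1])
  from tendsto_mult_left[OF this, of H] show ?thesis by simp
qed

text \<open>The content with exponent \<open>u\<close> is at most \<open>H * r powr (u - t)\<close>,
  which tends to \<open>0\<close>. The requirement \<open>n \<ge> 1\<close> forces
  \<open>t \<ge> 0\<close>, so \<open>u\<close> is among the nonnegative exponents over which the
  dimension is an infimum.\<close>

lemma upper_minkowski_dim_le_of_covers:
  fixes E :: "'a::metric_space set"
  assumes "R > 0" and "t < u"
    and cov: "\<And>r. 0 < r \<Longrightarrow> r < R \<Longrightarrow>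
      \<exists>n\<ge>1. \<exists>x::nat \<Rightarrow> 'a. E \<subseteq> (\<Union>k\<in>{1..n}. cball (x k) r) \<and> (\<forall>k\<in>{1..n}. x k \<in> E) \<and>
        real n \<le> H * r powr (- t)"
  shows "upper_minkowski_dim E \<le> ereal u"
proof -
  have near: "\<forall>\<^sub>F r in at_right 0. 0 < r \<and> r < R"
    using \<open>R > 0\<close> unfolding eventually_at_right_field by blast
  \<comment> \<open>For \<open>t < 0\<close> the bound would force \<open>n < 1\<close> for small \<open>r\<close>.\<close>
  have "0 \<le> t"
  proof (rule ccontr)
    assume "\<not> 0 \<le> t"
    then have "((\<lambda>r. H * r powr (- t)) \<longlongrightarrow> 0) (at_right 0)"
      by (intro tendsto_powr_at_right_0) simp
    then have "\<forall>\<^sub>F r in at_right 0. H * r powr (- t) < 1"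
      by (rule order_tendstoD) simp
    with near have "\<forall>\<^sub>F r in at_right (0::real). False"
    proof eventually_elim
      case (elim r)
      then obtain n :: nat where "n \<ge> 1" "real n \<le> H * r powr (- t)"
        using cov[of r] by blast
      with elim show False by simp
    qed
    then show False by simp
  qed
  have "\<forall>\<^sub>F r in at_right 0. minkowski_content u r E \<le> ereal (H * r powr (u - t))"
    using near
  proof eventually_elim
    case (elim r)
    then obtain n x where n: "E \<subseteq> (\<Union>k\<in>{1..n}. cball (x k) r)" "\<forall>k\<in>{1..n}. x k \<in> E"
        "real n \<le> H * r powr (- t)"
      using cov[of r] by blast
    have "minkowski_content u r E \<le> ereal (real n * r powr u)"
      unfolding minkowski_content_def using n by (intro Inf_lower) blast
    also have "real n * r powr u \<le> (H * r powr (- t)) * r powr u"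
      by (rule mult_right_mono[OF n(3)]) simp
    also have "\<dots> = H * r powr (u - t)"
      by (simp add: mult.assoc flip: powr_add)
    finally show ?case by simp
  qed
  then have "Limsup (at_right 0) (\<lambda>r. minkowski_content u r E) \<le>
      Limsup (at_right 0) (\<lambda>r. ereal (H * r powr (u - t)))"
    by (rule Limsup_mono)
  also have "\<dots> = ereal 0"
    using tendsto_powr_at_right_0[of "u - t" H] \<open>t < u\<close>
    by (intro lim_imp_Limsup) (simp_all add: trivial_limit_at_right_real)
  finally have "Limsup (at_right 0) (\<lambda>r. minkowski_content u r E) \<le> 0"
    by (simp add: zero_ereal_def)
  moreover have "0 \<le> Limsup (at_right 0) (\<lambda>r. minkowski_content u r E)"
    by (rule le_Limsup)
      (auto simp: trivial_limit_at_right_real minkowski_content_def intro!: always_eventually Inf_greatest)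
  ultimately have "Limsup (at_right 0) (\<lambda>r. minkowski_content u r E) = 0"
    by (rule antisym)
  then show ?thesis
    unfolding upper_minkowski_dim_def using \<open>0 \<le> t\<close> \<open>t < u\<close> by (intro Inf_lower) auto
qed

lemma upper_minkowski_dim_le_limsup_whitney_rate:
  fixes E :: "'a::metric_space set"
  assumes "\<exists>x y::'a. x \<noteq> y"
    and "compact E" and "E \<noteq> {}" and W: "whitney_cover (- E) I c \<rho>"
    and "s > 0" and \<mu>: "borel_regular_measure \<mu>" and reg: "regular_measure s \<mu>" and "\<mu> E = 0"
  shows "upper_minkowski_dim E \<le> limsup (whitney_rate I \<rho>)"
proof (rule ccontr)
  assume "\<not> ?thesis"
  then obtain u where u: "limsup (whitney_rate I \<rho>) < ereal u" "ereal u < upper_minkowski_dim E"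
    using ereal_dense2 by (metis not_le)
  \<comment> \<open>Two intermediate exponents are needed: \<open>m\<close> bounds the counts, and
    the gap up to \<open>u\<close> makes the content vanish.\<close>
  obtain m where m: "limsup (whitney_rate I \<rho>) < ereal m" "m < u"
    using ereal_dense2[OF u(1)] by auto
  define t where "t = min m s"
  have "t < u" using m(2) unfolding t_def by simp
  obtain M where M: "sets M = sets borel" "\<And>A. A \<in> sets borel \<Longrightarrow> emeasure M A = \<mu> A"
    using borel_regular_measureE[OF \<mu>] by blast
  obtain C where C: "C \<ge> 1" "\<And>x r. 0 < r \<Longrightarrow> ereal r < space_diam TYPE('a) \<Longrightarrow>
        ennreal (inverse C * r powr s) \<le> \<mu> (cball x r) \<and> \<mu> (cball x r) \<le> ennreal (C * r powr s)"
    using reg unfolding regular_measure_def by blast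
  \<comment> \<open>Two distinct points make the diameter positive, so the regularity bounds hold at
    all small radii.\<close>
  obtain a b :: 'a where "a \<noteq> b" using assms(1) by blast
  have "ereal (dist a b / 2) < ereal (dist a b)" using \<open>a \<noteq> b\<close> by simp
  also have "\<dots> \<le> space_diam TYPE('a)"
    unfolding space_diam_def by (rule SUP_upper2[of "(a, b)"]) auto
  finally have R: "ereal (dist a b / 2) < space_diam TYPE('a)" .
  have "\<forall>\<^sub>F k in sequentially. (1/2::real) ^ k < dist a b / 2"
    using \<open>a \<noteq> b\<close> by (intro order_tendstoD(2)[OF LIMSEQ_power_zero]) auto
  with Limsup_lessD[OF m(1)] eventually_gt_at_top[of 0]
  have "\<forall>\<^sub>F k in sequentially. whitney_rate I \<rho> k < ereal m \<and> (1/2) ^ k < dist a b / 2 \<and> k > 0"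
    by eventually_elim blast
  then obtain K where K: "\<And>k. k \<ge> K \<Longrightarrow> whitney_rate I \<rho> k < ereal m \<and> k > 0"
      "(1/2) ^ K < dist a b / 2"
    by (auto simp: eventually_sequentially)
  have ball: "ennreal (inverse C * r powr s) \<le> emeasure M (cball x r)"
      "emeasure M (cball x r) \<le> ennreal (C * r powr s)"
    if "0 < r" "r \<le> (1/2) ^ K" for x r
  proof -
    have "ereal r < ereal (dist a b / 2)" using that K(2) by simp
    then have "ereal r < space_diam TYPE('a)" using R by (rule less_trans)
    with C(2)[OF that(1), of x] M(2) show "ennreal (inverse C * r powr s) \<le> emeasure M (cball x r)"
      "emeasure M (cball x r) \<le> ennreal (C * r powr s)" by auto
  qed
  have E0: "emeasure M E = 0"
    using M(2) \<open>\<mu> E = 0\<close> \<open>compact E\<close> by (simp add: borel_compact)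
  obtain A where A: "A \<ge> 0" "\<And>r. 0 < r \<Longrightarrow> r \<le> (1/2) ^ K \<Longrightarrow>
      emeasure M {z. infdist z E \<le> r} \<le> ennreal (A * r powr (s - t))"
  proof (cases "m < s")
    case True
    then have t: "t = m" by (simp add: t_def)
    have lev: "finite (whitney_level I \<rho> (int k)) \<and>
      real (card (whitney_level I \<rho> (int k))) \<le> 2 powr (real k * t)" if "k \<ge> K" for k
      using whitney_rate_lessD[of I \<rho> k m] K(1)[OF that] t by blast
    show thesis
      by (rule emeasure_neighbourhood_le[OF W \<open>E \<noteq> {}\<close> M(1) E0 _ _ ball(2) lev _ that])
        (use C(1) \<open>s > 0\<close> True t in auto)
  next
    case False
    \<comment> \<open>Now \<open>r powr (s - t) = 1\<close>, so a bound uniform in \<open>r\<close>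
      suffices; \<open>(1/2) ^ K \<le> 1\<close> puts all neighbourhoods inside
      \<open>?U 1\<close>.\<close>
    then have t: "t = s" by (simp add: t_def)
    let ?U = "\<lambda>r. {z. infdist z E \<le> r}"
    have Ub: "?U r \<in> sets borel" for r
      by (rule borel_closed[OF closed_infdist_le])
    have fin: "emeasure M (?U 1) < \<infinity>"
      using M(2)[OF Ub] bounded_infdist_le[OF compact_imp_bounded[OF \<open>compact E\<close>] \<open>E \<noteq> {}\<close>] \<mu>
      unfolding borel_regular_measure_def by metis
    show thesis
    proof (rule that)
      fix r :: real assume r: "0 < r" "r \<le> (1/2) ^ K"
      have "(1/2::real) ^ K \<le> 1" by (intro power_le_one) auto
      then have "emeasure M (?U r) \<le> emeasure M (?U 1)"
        using r Ub M(1) by (intro emeasure_mono) auto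
      also have "\<dots> = ennreal (enn2real (emeasure M (?U 1)) * r powr (s - t))"
        using fin r t by (simp add: less_top)
      finally show "emeasure M (?U r) \<le> ennreal (enn2real (emeasure M (?U 1)) * r powr (s - t))" .
    qed simp
  qed
  have "upper_minkowski_dim E \<le> ereal u"
  \<comment> \<open>\<open>H\<close> is the constant left on dividing
    \<open>A * r powr (s - t)\<close> by the lower regularity bound
    \<open>inverse C * (r / 2) powr s\<close>.\<close>
  proof (rule upper_minkowski_dim_le_of_covers[where R = "(1/2) ^ K" and H = "A * C * 2 powr s"])
    fix r :: real assume r: "0 < r" "r < (1/2) ^ K"
    define v where "v = inverse C * (r / 2) powr s"
    have v: "0 < v" unfolding v_def using C(1) r by simp
    have B: "0 \<le> A * r powr (s - t)"
      using A(1) by simp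
    have low: "ennreal v \<le> emeasure M (cball x (r / 2))" for x
      unfolding v_def using r by (intro ball) auto
    have up: "emeasure M {z. infdist z E \<le> r} \<le> ennreal (A * r powr (s - t))"
      using A(2) r by simp
    obtain n and x :: "nat \<Rightarrow> 'a" where n: "n \<ge> 1" "E \<subseteq> (\<Union>k\<in>{1..n}. cball (x k) r)"
        "\<forall>k\<in>{1..n}. x k \<in> E" "real n * v \<le> A * r powr (s - t)"
      using maximal_separated_cover[OF \<open>E \<noteq> {}\<close> M(1) r(1) v B low up] .
    have "real n \<le> A * r powr (s - t) / v"
      using n(4) v by (simp add: field_simps)
    also have "\<dots> = A * C * 2 powr s * r powr (- t)"
      unfolding v_def using r C(1) by (simp add: powr_divide powr_diff powr_minus field_simps)
    finally show "\<exists>n\<ge>1. \<exists>x::nat \<Rightarrow> 'a. E \<subseteq> (\<Union>k\<in>{1..n}. cball (x k) r) \<and> (\<forall>k\<in>{1..n}. x k \<in> E) \<and>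
        real n \<le> A * C * 2 powr s * r powr (- t)"
      using n by blast
  qed (use \<open>t < u\<close> in auto)
  with u(2) show False by simp
qed

theorem theorem4p2:
  fixes E :: "'a::metric_space set"
    and I :: "'i set" and c :: "'i \<Rightarrow> 'a" and \<rho> :: "'i \<Rightarrow> real"
  assumes "\<exists>x y::'a. x \<noteq> y"
    and "doubling_space TYPE('a)"
    and "compact E" and "E \<noteq> {}" and "E \<noteq> UNIV"
    and "whitney_cover (- E) I c \<rho>"
  shows "lower_minkowski_dim E \<ge> liminf (whitney_rate I \<rho>) \<and>
    (\<forall>(s::real) (\<mu>::'a set \<Rightarrow> ennreal).
       s > 0 \<and> borel_regular_measure \<mu> \<and> regular_measure s \<mu> \<and> \<mu> E = 0 \<longrightarrow>
       upper_minkowski_dim E = limsup (whitney_rate I \<rho>))"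
  using liminf_whitney_rate_le_lower_minkowski_dim[OF assms(2,4,6)]
    limsup_whitney_rate_le_upper_minkowski_dim[OF assms(2,4,6)]
    upper_minkowski_dim_le_limsup_whitney_rate[OF assms(1,3,4,6)]
  by (blast intro: antisym)

end
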